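(* Consider an ontological model of a quantum system $S$ with ontic space $\Lambda$. For any two POVMs $\{E_i\}_i$ and $\{E'_k\}_k$ on the Hilbert space of $S$, $$\bigcup_i \mathrm{Supp}(\xi_{E_i}) = \bigcup_k \mathrm{Supp}(\xi_{E'_k}),$$ i.e. the support of the set of indicator functions is the same subset of $\Lambda$ for every POVM.
   Context: An ontological model of a quantum system $S$ with finite-dimensional complex Hilbert space $H$ consists of a measure space $\Lambda$ (the ontic space, whose points $\lambda$ are ontic states; integration is written $d\lambda$) together with the following data. (1) For each pure state (unit vector) $\psi \in H$ and each preparation setting $P$ for $\psi$, a probability density $\rho(\lambda|\psi,P)\ge 0$ on $\Lambda$. (2) For each POVM $\{E_i\}$ (finitely many positive operators with $\sum_i E_i = 1$) a nonempty set of measurement settings $M$ implementing it, and for each such $M$ measurable indicator (response) functions $\xi_{E_i}(\cdot,M):\Lambda\to[0,1]$ satisfying the normalization $\sum_i \xi_{E_i}(\lambda,M)=1$ for every $\lambda\in\Lambda$. (3) Born's rule is reproduced: for every POVM $\{E_i\}$, every setting $M$ implementing it, every pure state $\psi$ and every preparation setting $P$ for $\psi$, $\int d\lambda\,\xi_{E_i}(\lambda,M)\rho(\lambda|\psi,P)=\langle\psi|E_i|\psi\rangle$. The support is $\mathrm{Supp}(\xi_{E_i}(\cdot,M))=\{\lambda: \xi_{E_i}(\lambda,M)\neq 0\}$. When no setting label appears, $\mathrm{Supp}(\xi_{E_i})$ denotes the union of $\mathrm{Supp}(\xi_{E_i}(\cdot,M))$ over all settings $M$ implementing the POVM $\{E_i\}$.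 *)

theory Defs
  imports "HOL-Analysis.Analysis"
begin

text \<open>The finite-dimensional Hilbert space is \<open>complex ^ 'n\<close>; operators on it are square matrices.\<close>

definition cinner :: "complex ^ 'n \<Rightarrow> complex ^ 'n \<Rightarrow> complex"
  where "cinner u v = (\<Sum>j\<in>UNIV. cnj (u $ j) * v $ j)"

lemma cinner_self: "cinner v v = complex_of_real ((norm v)\<^sup>2)"
  by (simp add: cinner_def norm_vec_def L2_set_def sum_nonneg mult.commute[of "cnj _"]
      flip: complex_norm_square)

definition positive_op :: "complex ^ 'n ^ 'n \<Rightarrow> bool"
  where "positive_op E \<longleftrightarrow> (\<forall>v. cinner v (E *v v) \<in> \<real> \<and> 0 \<le> Re (cinner v (E *v v)))"

text \<open>A finite family of operators, possibly with repetitions, is a list; outcomes are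
  the positions in the list.\<close>

definition povm :: "(complex ^ 'n ^ 'n) list \<Rightarrow> bool"
  where "povm Es \<longleftrightarrow> (\<forall>E\<in>set Es. positive_op E) \<and> sum_list Es = mat 1"

text \<open>
  \<open>prep \<psi>\<close> is the set of preparation settings for \<open>\<psi>\<close>, and \<open>\<rho> \<psi> P\<close> the density
  \<open>\<rho>(\<cdot>|\<psi>,P)\<close> with respect to the measure \<open>\<Lambda>\<close>.
  \<open>meas Es\<close> is the set of measurement settings implementing \<open>Es\<close>, and \<open>\<xi> Es M i\<close> the
  response function of the \<open>i\<close>-th outcome under \<open>M\<close>; it may depend on the whole POVM.
\<close>

locale ontological_model =
  fixes \<Lambda> :: "'l measure"
    and prep :: "complex ^ 'n \<Rightarrow> 'p set"
    and \<rho> :: "complex ^ 'n \<Rightarrow> 'p \<Rightarrow> 'l \<Rightarrow> real"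
    and meas :: "(complex ^ 'n ^ 'n) list \<Rightarrow> 'm set"
    and \<xi> :: "(complex ^ 'n ^ 'n) list \<Rightarrow> 'm \<Rightarrow> nat \<Rightarrow> 'l \<Rightarrow> real"
  assumes density_nonneg:
      "\<And>\<psi> P l. norm \<psi> = 1 \<Longrightarrow> P \<in> prep \<psi> \<Longrightarrow> l \<in> space \<Lambda> \<Longrightarrow> 0 \<le> \<rho> \<psi> P l"
    and density_normalized:
      "\<And>\<psi> P. norm \<psi> = 1 \<Longrightarrow> P \<in> prep \<psi> \<Longrightarrow> has_bochner_integral \<Lambda> (\<rho> \<psi> P) 1"
    and meas_nonempty: "\<And>Es. povm Es \<Longrightarrow> meas Es \<noteq> {}"
    and response_measurable:
      "\<And>Es M i. povm Es \<Longrightarrow> M \<in> meas Es \<Longrightarrow> i < length Es \<Longrightarrow> \<xi> Es M i \<in> borel_measurable \<Lambda>"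
    and response_range:
      "\<And>Es M i l. povm Es \<Longrightarrow> M \<in> meas Es \<Longrightarrow> i < length Es \<Longrightarrow> l \<in> space \<Lambda> \<Longrightarrow> \<xi> Es M i l \<in> {0..1}"
    and response_normalized:
      "\<And>Es M l. povm Es \<Longrightarrow> M \<in> meas Es \<Longrightarrow> l \<in> space \<Lambda> \<Longrightarrow> (\<Sum>i<length Es. \<xi> Es M i l) = 1"
    and born_rule:
      "\<And>Es M i \<psi> P. povm Es \<Longrightarrow> M \<in> meas Es \<Longrightarrow> i < length Es \<Longrightarrow> norm \<psi> = 1 \<Longrightarrow> P \<in> prep \<psi> \<Longrightarrow>
        complex_of_real (\<integral>l. \<xi> Es M i l * \<rho> \<psi> P l \<partial>\<Lambda>) = cinner \<psi> ((Es ! i) *v \<psi>)"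

definition setting_supp :: "'l measure \<Rightarrow> ('l \<Rightarrow> real) \<Rightarrow> 'l set"
  where "setting_supp \<Lambda> f = {l \<in> space \<Lambda>. f l \<noteq> 0}"

definition outcome_supp ::
  "'l measure \<Rightarrow> ((complex ^ 'n ^ 'n) list \<Rightarrow> 'm set) \<Rightarrow>
    ((complex ^ 'n ^ 'n) list \<Rightarrow> 'm \<Rightarrow> nat \<Rightarrow> 'l \<Rightarrow> real) \<Rightarrow> (complex ^ 'n ^ 'n) list \<Rightarrow> nat \<Rightarrow> 'l set"
  where "outcome_supp \<Lambda> meas \<xi> Es i = (\<Union>M\<in>meas Es. setting_supp \<Lambda> (\<xi> Es M i))"

end

theory Submission imports Defs begin

text \<open>Both unions equal the whole ontic space, so they coincide. At each ontic state the
  responses of any one setting sum to 1, hence some outcome has a nonzero response there: a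
  measurement always yields some result. \<open>UN_outcome_supp_eq_space\<close> records this for a
  single POVM, and the theorem applies it to each of the two.\<close>

lemma (in ontological_model) UN_outcome_supp_eq_space:
  assumes "povm Es"
  shows "(\<Union>i<length Es. outcome_supp \<Lambda> meas \<xi> Es i) = space \<Lambda>"
proof
  show "(\<Union>i<length Es. outcome_supp \<Lambda> meas \<xi> Es i) \<subseteq> space \<Lambda>"
    by (auto simp: outcome_supp_def setting_supp_def)
  show "space \<Lambda> \<subseteq> (\<Union>i<length Es. outcome_supp \<Lambda> meas \<xi> Es i)"
  proof
    fix l assume l: "l \<in> space \<Lambda>"
    \<comment> \<open>The supports are unions over settings, so one setting suffices to cover
      \<open>l\<close>; were \<open>meas Es\<close> empty, the union would be empty too.\<close>
    obtain M where M: "M \<in> meas Es"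
      using meas_nonempty[OF assms] by blast
    have "(\<Sum>i<length Es. \<xi> Es M i l) \<noteq> 0"
      using response_normalized[OF assms M l] by simp
    \<comment> \<open>If every response vanished at \<open>l\<close>, the sum would be 0. The
      outcome \<open>i\<close> may vary with \<open>l\<close>.\<close>
    then obtain i where "i < length Es" "\<xi> Es M i l \<noteq> 0"
      by (metis lessThan_iff sum.neutral)
    with M l show "l \<in> (\<Union>i<length Es. outcome_supp \<Lambda> meas \<xi> Es i)"
      by (auto simp: outcome_supp_def setting_supp_def)
  qed
qed

theorem lemma1:
  fixes \<Lambda> :: "'l measure"
    and prep :: "complex ^ 'n \<Rightarrow> 'p set"
    and \<rho> :: "complex ^ 'n \<Rightarrow> 'p \<Rightarrow> 'l \<Rightarrow> real"
    and meas :: "(complex ^ 'n ^ 'n) list \<Rightarrow> 'm set"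
    and \<xi> :: "(complex ^ 'n ^ 'n) list \<Rightarrow> 'm \<Rightarrow> nat \<Rightarrow> 'l \<Rightarrow> real"
    and Es Es' :: "(complex ^ 'n ^ 'n) list"
  assumes "ontological_model \<Lambda> prep \<rho> meas \<xi>"
    and "povm Es" and "povm Es'"
  shows "(\<Union>i<length Es. outcome_supp \<Lambda> meas \<xi> Es i) =
    (\<Union>k<length Es'. outcome_supp \<Lambda> meas \<xi> Es' k)"
  using assms by (simp add: ontological_model.UN_outcome_supp_eq_space)

end
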